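(* There is a one-to-one correspondence between strict $\mathrm{Dend}_\infty$-algebras and crossed modules of dendriform algebras.
   Context: $\mathbb{K}$ is a field of characteristic $0$. $C_n=\{[1],\ldots,[n]\}$ is a set of $n$ symbols, $\mathbb{K}[C_n]$ the vector space with basis $C_n$. For $1\le i\le m$, $n\ge 1$: $R_0^{m,n,i}:C_{m+n-1}\to C_m$ sends $[r]$ to $[r]$ if $r\le i-1$, to $[i]$ if $i\le r\le i+n-1$, to $[r-n+1]$ if $r\ge i+n$; $R^{m,n,i}:C_{m+n-1}\to\mathbb{K}[C_n]$ sends $[r]$ to $[r-i+1]$ if $i\le r\le i+n-1$ and to $[1]+\cdots+[n]$ otherwise. For maps $f$ with $m$ inputs labelled by $C_m$ and $g$ with $n$ inputs labelled by $C_n$ (extended linearly in the label), $(f\circ_i g)([r];x_1,\ldots,x_{m+n-1})=f(R_0^{m,n,i}[r];x_1,\ldots,x_{i-1},g(R^{m,n,i}[r];x_i,\ldots,x_{i+n-1}),x_{i+n},\ldots,x_{m+n-1})$ whenever the inputs make sense. A $2$-term $\mathrm{Dend}_\infty$-algebra $(A_1\xrightarrow{d}A_0,\mu_2,\mu_3)$ consists of a chain complex $A_1\xrightarrow{d}A_0$, bilinear maps $\mu_2:\mathbb{K}[C_2]\otimes(A_i\otimes A_j)\to A_{i+j}$ (with $A_2=0$) and a trilinear map $\mu_3:\mathbb{K}[C_3]\otimes(A_0\otimes A_0\otimes A_0)\to A_1$ such that for all $a,b,c,e\in A_0$, $m,n\in A_1$, $[r]\in C_2$, $[s]\in C_3$,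 $[t]\in C_4$: (i) $\mu_2([r];m,n)=0$; (ii) $d\mu_2([r];a,m)=\mu_2([r];a,dm)$; (iii) $d\mu_2([r];m,a)=\mu_2([r];dm,a)$; (iv) $\mu_2([r];dm,n)=\mu_2([r];m,dn)$; (v) $(\mu_2\circ_1\mu_2-\mu_2\circ_2\mu_2)([s];a,b,c)=d\mu_3([s];a,b,c)$; (vi1) $(\mu_2\circ_1\mu_2-\mu_2\circ_2\mu_2)([s];a,b,m)=\mu_3([s];a,b,dm)$; (vi2) $(\mu_2\circ_1\mu_2-\mu_2\circ_2\mu_2)([s];a,m,c)=\mu_3([s];a,dm,c)$; (vi3) $(\mu_2\circ_1\mu_2-\mu_2\circ_2\mu_2)([s];m,b,c)=\mu_3([s];dm,b,c)$; (vii) $(\mu_3\circ_1\mu_2-\mu_3\circ_2\mu_2+\mu_3\circ_3\mu_2)([t];a,b,c,e)=(\mu_2\circ_1\mu_3+\mu_2\circ_2\mu_3)([t];a,b,c,e)$. A $2$-term $\mathrm{Dend}_\infty$-algebra is called strict if $\mu_3=0$; a strict $\mathrm{Dend}_\infty$-algebra always means a strict $2$-term one. Dendriform algebra: a vector space $A$ with bilinear $\prec,\succ$ satisfying (D1) $(a\prec b)\prec c=a\prec(b\prec c+b\succ c)$, (D2) $(a\succ b)\prec c=a\succ(b\prec c)$, (D3) $(a\prec b+a\succ b)\succ c=a\succ(b\succ c)$; encoded by $\pi_A([1];a,b)=a\prec b$, $\pi_A([2];a,b)=a\succ b$. Morphisms are linear maps preserving both products. A representation of a dendriform algebra $B$ on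 a vector space $M$ consists of bilinear maps $\prec,\succ:B\otimes M\to M$ and $\prec,\succ:M\otimes B\to M$ such that (D1)-(D3) hold whenever exactly one of $a,b,c$ is in $M$ and the other two are in $B$; encoded by $\theta_1([1];b,m)=b\prec m$, $\theta_1([2];b,m)=b\succ m$, $\theta_2([1];m,b)=m\prec b$, $\theta_2([2];m,b)=m\succ b$. A crossed module of dendriform algebras is a tuple $(A,B,dt,\theta_1,\theta_2)$ where $A,B$ are dendriform algebras, $dt:A\to B$ is a morphism of dendriform algebras, and $\theta_1:\mathbb{K}[C_2]\otimes(B\otimes A)\to A$, $\theta_2:\mathbb{K}[C_2]\otimes(A\otimes B)\to A$ define a representation of $B$ on $A$, such that for $m,n\in A$, $b\in B$, $[r]\in C_2$, $[s]\in C_3$: $dt(\theta_1([r];b,m))=\pi_B([r];b,dt(m))$; $dt(\theta_2([r];m,b))=\pi_B([r];dt(m),b)$; $\theta_1([r];dt(m),n)=\pi_A([r];m,n)$; $\theta_2([r];m,dt(n))=\pi_A([r];m,n)$; $(\theta_1\circ_2\pi_A)([s];b,m,n)=(\pi_A\circ_1\theta_1)([s];b,m,n)$; $(\theta_2\circ_1\pi_A)([s];m,n,b)=(\pi_A\circ_2\theta_2)([s];m,n,b)$. *)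

theory Defs
  imports Complex_Main
begin

section \<open>Labels and partial compositions\<close>

text \<open>
  The symbol \<open>[r]\<close> of \<open>C\<^sub>n\<close> is the natural number \<open>r \<in> {1..n}\<close>; a vector of \<open>\<K>[C\<^sub>n]\<close> is its
  coefficient function \<open>nat \<Rightarrow> 'k\<close>.
\<close>

definition C :: "nat \<Rightarrow> nat set" where
  "C n = {1..n}"

definition R0 :: "nat \<Rightarrow> nat \<Rightarrow> nat \<Rightarrow> nat \<Rightarrow> nat" where
  "R0 m n i r = (if r \<le> i - 1 then r else if r \<le> i + n - 1 then i else r - n + 1)"

definition R :: "nat \<Rightarrow> nat \<Rightarrow> nat \<Rightarrow> nat \<Rightarrow> (nat \<Rightarrow> 'k::field)" where
  "R m n i r =
     (if i \<le> r \<and> r \<le> i + n - 1 then (\<lambda>j. if j = r - i + 1 then 1 else 0)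
      else (\<lambda>j. if j \<in> C n then 1 else 0))"

definition label_extend ::
  "('k::field \<Rightarrow> 'p::ab_group_add \<Rightarrow> 'p) \<Rightarrow> nat \<Rightarrow> (nat \<Rightarrow> 'p) \<Rightarrow> (nat \<Rightarrow> 'k) \<Rightarrow> 'p" where
  "label_extend s n g v = (\<Sum>j\<in>C n. s (v j) (g j))"

text \<open>
  \<open>insert_op s m n i r F G\<close> is \<open>(f \<circ>\<^sub>i g)([r]; x\<^sub>1, \<dots>, x\<^sub>m\<^sub>+\<^sub>n\<^sub>-\<^sub>1)\<close> where \<open>F l y\<close> is
  \<open>f([l]; x\<^sub>1, \<dots>, x\<^sub>i\<^sub>-\<^sub>1, y, x\<^sub>i\<^sub>+\<^sub>n, \<dots>)\<close>, \<open>G l\<close> is \<open>g([l]; x\<^sub>i, \<dots>, x\<^sub>i\<^sub>+\<^sub>n\<^sub>-\<^sub>1)\<close>, and \<open>s\<close> is the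
  scalar multiplication of the space in which \<open>g\<close> takes its values. The operations
  \<open>comp_m_n_i\<close> are the instances needed below; they are polymorphic, so that every input may come
  from its own space.
\<close>

definition insert_op ::
  "('k::field \<Rightarrow> 'p::ab_group_add \<Rightarrow> 'p) \<Rightarrow> nat \<Rightarrow> nat \<Rightarrow> nat \<Rightarrow> nat \<Rightarrow>
   (nat \<Rightarrow> 'p \<Rightarrow> 'q) \<Rightarrow> (nat \<Rightarrow> 'p) \<Rightarrow> 'q" where
  "insert_op s m n i r F G = F (R0 m n i r) (label_extend s n G (R m n i r))"

definition "comp_2_2_1 s f g r a b c = insert_op s 2 2 1 r (\<lambda>l y. f l y c) (\<lambda>l. g l a b)"
definition "comp_2_2_2 s f g r a b c = insert_op s 2 2 2 r (\<lambda>l y. f l a y) (\<lambda>l. g l b c)"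

definition "comp_3_2_1 s f g r a b c e = insert_op s 3 2 1 r (\<lambda>l y. f l y c e) (\<lambda>l. g l a b)"
definition "comp_3_2_2 s f g r a b c e = insert_op s 3 2 2 r (\<lambda>l y. f l a y e) (\<lambda>l. g l b c)"
definition "comp_3_2_3 s f g r a b c e = insert_op s 3 2 3 r (\<lambda>l y. f l a b y) (\<lambda>l. g l c e)"

definition "comp_2_3_1 s f g r a b c e = insert_op s 2 3 1 r (\<lambda>l y. f l y e) (\<lambda>l. g l a b c)"
definition "comp_2_3_2 s f g r a b c e = insert_op s 2 3 2 r (\<lambda>l y. f l a y) (\<lambda>l. g l b c e)"


section \<open>Multilinear maps\<close>

definition bilinear_map ::
  "('k::field \<Rightarrow> 'x::ab_group_add \<Rightarrow> 'x) \<Rightarrow> ('k \<Rightarrow> 'y::ab_group_add \<Rightarrow> 'y) \<Rightarrow>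
   ('k \<Rightarrow> 'z::ab_group_add \<Rightarrow> 'z) \<Rightarrow> ('x \<Rightarrow> 'y \<Rightarrow> 'z) \<Rightarrow> bool" where
  "bilinear_map sx sy sz f \<longleftrightarrow>
     (\<forall>x. Vector_Spaces.linear sy sz (f x)) \<and>
     (\<forall>y. Vector_Spaces.linear sx sz (\<lambda>x. f x y))"

definition trilinear_map ::
  "('k::field \<Rightarrow> 'x::ab_group_add \<Rightarrow> 'x) \<Rightarrow> ('k \<Rightarrow> 'y::ab_group_add \<Rightarrow> 'y) \<Rightarrow>
   ('k \<Rightarrow> 'z::ab_group_add \<Rightarrow> 'z) \<Rightarrow> ('k \<Rightarrow> 'w::ab_group_add \<Rightarrow> 'w) \<Rightarrow>
   ('x \<Rightarrow> 'y \<Rightarrow> 'z \<Rightarrow> 'w) \<Rightarrow> bool" where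
  "trilinear_map sx sy sz sw f \<longleftrightarrow>
     (\<forall>x y. Vector_Spaces.linear sz sw (\<lambda>z. f x y z)) \<and>
     (\<forall>x z. Vector_Spaces.linear sy sw (\<lambda>y. f x y z)) \<and>
     (\<forall>y z. Vector_Spaces.linear sx sw (\<lambda>x. f x y z))"

text \<open>
  A linear map \<open>\<K>[C\<^sub>n] \<otimes> (X \<otimes> Y) \<rightarrow> Z\<close> is given by its values on the basis symbols. The value \<open>0\<close>
  prescribed at naturals outside \<open>C\<^sub>n\<close> carries no information: it makes the family of type
  \<open>nat \<Rightarrow> _\<close> uniquely determined by the linear map it encodes.
\<close>

definition labelled_bilinear where
  "labelled_bilinear n sx sy sz f \<longleftrightarrow>
     (\<forall>r\<in>C n. bilinear_map sx sy sz (f r)) \<and> (\<forall>r. r \<notin> C n \<longrightarrow> f r = (\<lambda>x y. 0))"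

definition labelled_trilinear where
  "labelled_trilinear n sx sy sz sw f \<longleftrightarrow>
     (\<forall>r\<in>C n. trilinear_map sx sy sz sw (f r)) \<and> (\<forall>r. r \<notin> C n \<longrightarrow> f r = (\<lambda>x y z. 0))"


section \<open>Two-term \<open>Dend\<^sub>\<infinity>\<close>-algebras\<close>

text \<open>
  \<open>scale1\<close>, \<open>scale0\<close> are the scalar multiplications of \<open>A\<^sub>1\<close>, \<open>A\<^sub>0\<close>, and \<open>mu\<^sub>i\<^sub>j\<close> is the component
  \<open>A\<^sub>i \<otimes> A\<^sub>j \<rightarrow> A\<^sub>i\<^sub>+\<^sub>j\<close> of \<open>\<mu>\<^sub>2\<close>. The component on \<open>A\<^sub>1 \<otimes> A\<^sub>1\<close> takes values in \<open>A\<^sub>2 = 0\<close>, so it is no datum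
  and the axiom \<open>\<mu>\<^sub>2([r]; m, n) = 0\<close> holds by construction.
\<close>

record ('k, 'a1, 'a0) two_term =
  scale1 :: "'k \<Rightarrow> 'a1 \<Rightarrow> 'a1"
  scale0 :: "'k \<Rightarrow> 'a0 \<Rightarrow> 'a0"
  diff :: "'a1 \<Rightarrow> 'a0"
  mu00 :: "nat \<Rightarrow> 'a0 \<Rightarrow> 'a0 \<Rightarrow> 'a0"
  mu01 :: "nat \<Rightarrow> 'a0 \<Rightarrow> 'a1 \<Rightarrow> 'a1"
  mu10 :: "nat \<Rightarrow> 'a1 \<Rightarrow> 'a0 \<Rightarrow> 'a1"
  mu3 :: "nat \<Rightarrow> 'a0 \<Rightarrow> 'a0 \<Rightarrow> 'a0 \<Rightarrow> 'a1"

locale two_term_axioms =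
  A1: vector_space s1 + A0: vector_space s0 + d: Vector_Spaces.linear s1 s0 d
  for s1 :: "'k::field_char_0 \<Rightarrow> 'a1::ab_group_add \<Rightarrow> 'a1"
    and s0 :: "'k \<Rightarrow> 'a0::ab_group_add \<Rightarrow> 'a0"
    and d :: "'a1 \<Rightarrow> 'a0" +
  fixes \<mu>00 :: "nat \<Rightarrow> 'a0 \<Rightarrow> 'a0 \<Rightarrow> 'a0"
    and \<mu>01 :: "nat \<Rightarrow> 'a0 \<Rightarrow> 'a1 \<Rightarrow> 'a1"
    and \<mu>10 :: "nat \<Rightarrow> 'a1 \<Rightarrow> 'a0 \<Rightarrow> 'a1"
    and \<mu>3 :: "nat \<Rightarrow> 'a0 \<Rightarrow> 'a0 \<Rightarrow> 'a0 \<Rightarrow> 'a1"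
  assumes mu00: "labelled_bilinear 2 s0 s0 s0 \<mu>00"
    and mu01: "labelled_bilinear 2 s0 s1 s1 \<mu>01"
    and mu10: "labelled_bilinear 2 s1 s0 s1 \<mu>10"
    and mu3: "labelled_trilinear 3 s0 s0 s0 s1 \<mu>3"
    and ii: "r \<in> C 2 \<Longrightarrow> d (\<mu>01 r a m) = \<mu>00 r a (d m)"
    and iii: "r \<in> C 2 \<Longrightarrow> d (\<mu>10 r m a) = \<mu>00 r (d m) a"
    and iv: "r \<in> C 2 \<Longrightarrow> \<mu>01 r (d m) n = \<mu>10 r m (d n)"
    and v: "s \<in> C 3 \<Longrightarrow>
      comp_2_2_1 s0 \<mu>00 \<mu>00 s a b c - comp_2_2_2 s0 \<mu>00 \<mu>00 s a b c = d (\<mu>3 s a b c)"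
    and vi1: "s \<in> C 3 \<Longrightarrow>
      comp_2_2_1 s0 \<mu>01 \<mu>00 s a b m - comp_2_2_2 s1 \<mu>01 \<mu>01 s a b m = \<mu>3 s a b (d m)"
    and vi2: "s \<in> C 3 \<Longrightarrow>
      comp_2_2_1 s1 \<mu>10 \<mu>01 s a m c - comp_2_2_2 s1 \<mu>01 \<mu>10 s a m c = \<mu>3 s a (d m) c"
    and vi3: "s \<in> C 3 \<Longrightarrow>
      comp_2_2_1 s1 \<mu>10 \<mu>10 s m b c - comp_2_2_2 s0 \<mu>10 \<mu>00 s m b c = \<mu>3 s (d m) b c"
    and vii: "t \<in> C 4 \<Longrightarrow>
      comp_3_2_1 s0 \<mu>3 \<mu>00 t a b c e - comp_3_2_2 s0 \<mu>3 \<mu>00 t a b c e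
        + comp_3_2_3 s0 \<mu>3 \<mu>00 t a b c e
      = comp_2_3_1 s1 \<mu>10 \<mu>3 t a b c e + comp_2_3_2 s1 \<mu>01 \<mu>3 t a b c e"

definition two_term_dend_infty ::
  "('k::field_char_0, 'a1::ab_group_add, 'a0::ab_group_add) two_term \<Rightarrow> bool" where
  "two_term_dend_infty X \<longleftrightarrow>
     two_term_axioms (scale1 X) (scale0 X) (diff X) (mu00 X) (mu01 X) (mu10 X) (mu3 X)"

definition strict_dend_infty ::
  "('k::field_char_0, 'a1::ab_group_add, 'a0::ab_group_add) two_term \<Rightarrow> bool" where
  "strict_dend_infty X \<longleftrightarrow> two_term_dend_infty X \<and> mu3 X = (\<lambda>s a b c. 0)"


section \<open>Dendriform algebras and representations\<close>

record ('k, 'a) dendriform =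
  scale :: "'k \<Rightarrow> 'a \<Rightarrow> 'a"
  dprec :: "'a \<Rightarrow> 'a \<Rightarrow> 'a"
  dsucc :: "'a \<Rightarrow> 'a \<Rightarrow> 'a"

locale dendriform_axioms = vector_space s
  for s :: "'k::field_char_0 \<Rightarrow> 'a::ab_group_add \<Rightarrow> 'a" +
  fixes prec :: "'a \<Rightarrow> 'a \<Rightarrow> 'a" (infixl \<open>\<prec>\<close> 70)
    and succ :: "'a \<Rightarrow> 'a \<Rightarrow> 'a" (infixl \<open>\<succ>\<close> 70)
  assumes bilinear_prec: "bilinear_map s s s (\<prec>)"
    and bilinear_succ: "bilinear_map s s s (\<succ>)"
    and D1: "(a \<prec> b) \<prec> c = a \<prec> (b \<prec> c + b \<succ> c)"
    and D2: "(a \<succ> b) \<prec> c = a \<succ> (b \<prec> c)"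
    and D3: "(a \<prec> b + a \<succ> b) \<succ> c = a \<succ> (b \<succ> c)"

definition dendriform_algebra ::
  "('k::field_char_0, 'a::ab_group_add) dendriform \<Rightarrow> bool" where
  "dendriform_algebra D \<longleftrightarrow> dendriform_axioms (scale D) (dprec D) (dsucc D)"

definition prod_of :: "('k, 'a::ab_group_add) dendriform \<Rightarrow> nat \<Rightarrow> 'a \<Rightarrow> 'a \<Rightarrow> 'a" where
  "prod_of D r a b = (if r = 1 then dprec D a b else if r = 2 then dsucc D a b else 0)"

definition dendriform_morphism ::
  "('k::field_char_0, 'a::ab_group_add) dendriform \<Rightarrow> ('k, 'b::ab_group_add) dendriform \<Rightarrow>
   ('a \<Rightarrow> 'b) \<Rightarrow> bool" where
  "dendriform_morphism D E f \<longleftrightarrow>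
     Vector_Spaces.linear (scale D) (scale E) f \<and>
     (\<forall>x y. f (dprec D x y) = dprec E (f x) (f y)) \<and>
     (\<forall>x y. f (dsucc D x y) = dsucc E (f x) (f y))"

text \<open>The subscripts \<open>L\<close>, \<open>R\<close> of the actions indicate on which side the element of \<open>B\<close> stands.\<close>

locale dendriform_rep_axioms =
  B: dendriform_axioms sB prec succ + M: vector_space sM
  for sB :: "'k::field_char_0 \<Rightarrow> 'b::ab_group_add \<Rightarrow> 'b"
    and prec :: "'b \<Rightarrow> 'b \<Rightarrow> 'b" (infixl \<open>\<prec>\<close> 70)
    and succ :: "'b \<Rightarrow> 'b \<Rightarrow> 'b" (infixl \<open>\<succ>\<close> 70)
    and sM :: "'k \<Rightarrow> 'm::ab_group_add \<Rightarrow> 'm" +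
  fixes prec_L :: "'b \<Rightarrow> 'm \<Rightarrow> 'm" (infixl \<open>\<prec>\<^sub>L\<close> 70)
    and succ_L :: "'b \<Rightarrow> 'm \<Rightarrow> 'm" (infixl \<open>\<succ>\<^sub>L\<close> 70)
    and prec_R :: "'m \<Rightarrow> 'b \<Rightarrow> 'm" (infixl \<open>\<prec>\<^sub>R\<close> 70)
    and succ_R :: "'m \<Rightarrow> 'b \<Rightarrow> 'm" (infixl \<open>\<succ>\<^sub>R\<close> 70)
  assumes bilinear_prec_L: "bilinear_map sB sM sM (\<prec>\<^sub>L)"
    and bilinear_succ_L: "bilinear_map sB sM sM (\<succ>\<^sub>L)"
    and bilinear_prec_R: "bilinear_map sM sB sM (\<prec>\<^sub>R)"
    and bilinear_succ_R: "bilinear_map sM sB sM (\<succ>\<^sub>R)"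
    and D1_1: "(m \<prec>\<^sub>R b) \<prec>\<^sub>R c = m \<prec>\<^sub>R (b \<prec> c + b \<succ> c)"
    and D2_1: "(m \<succ>\<^sub>R b) \<prec>\<^sub>R c = m \<succ>\<^sub>R (b \<prec> c)"
    and D3_1: "(m \<prec>\<^sub>R b + m \<succ>\<^sub>R b) \<succ>\<^sub>R c = m \<succ>\<^sub>R (b \<succ> c)"
    and D1_2: "(a \<prec>\<^sub>L m) \<prec>\<^sub>R c = a \<prec>\<^sub>L (m \<prec>\<^sub>R c + m \<succ>\<^sub>R c)"
    and D2_2: "(a \<succ>\<^sub>L m) \<prec>\<^sub>R c = a \<succ>\<^sub>L (m \<prec>\<^sub>R c)"
    and D3_2: "(a \<prec>\<^sub>L m + a \<succ>\<^sub>L m) \<succ>\<^sub>R c = a \<succ>\<^sub>L (m \<succ>\<^sub>R c)"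
    and D1_3: "(a \<prec> b) \<prec>\<^sub>L m = a \<prec>\<^sub>L (b \<prec>\<^sub>L m + b \<succ>\<^sub>L m)"
    and D2_3: "(a \<succ> b) \<prec>\<^sub>L m = a \<succ>\<^sub>L (b \<prec>\<^sub>L m)"
    and D3_3: "(a \<prec> b + a \<succ> b) \<succ>\<^sub>L m = a \<succ>\<^sub>L (b \<succ>\<^sub>L m)"

definition dendriform_representation where
  "dendriform_representation B sM pL sL pR sR \<longleftrightarrow>
     dendriform_rep_axioms (scale B) (dprec B) (dsucc B) sM pL sL pR sR"


section \<open>Crossed modules\<close>

record ('k, 'a, 'b) xmod =
  xA :: "('k, 'a) dendriform"
  xB :: "('k, 'b) dendriform"
  dt :: "'a \<Rightarrow> 'b"
  theta1 :: "nat \<Rightarrow> 'b \<Rightarrow> 'a \<Rightarrow> 'a"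
  theta2 :: "nat \<Rightarrow> 'a \<Rightarrow> 'b \<Rightarrow> 'a"

definition crossed_module ::
  "('k::field_char_0, 'a::ab_group_add, 'b::ab_group_add) xmod \<Rightarrow> bool" where
  "crossed_module Y \<longleftrightarrow>
     dendriform_algebra (xA Y) \<and>
     dendriform_algebra (xB Y) \<and>
     dendriform_morphism (xA Y) (xB Y) (dt Y) \<and>
     labelled_bilinear 2 (scale (xB Y)) (scale (xA Y)) (scale (xA Y)) (theta1 Y) \<and>
     labelled_bilinear 2 (scale (xA Y)) (scale (xB Y)) (scale (xA Y)) (theta2 Y) \<and>
     dendriform_representation (xB Y) (scale (xA Y))
       (theta1 Y 1) (theta1 Y 2) (theta2 Y 1) (theta2 Y 2) \<and>
     (\<forall>r\<in>C 2. \<forall>b m. dt Y (theta1 Y r b m) = prod_of (xB Y) r b (dt Y m)) \<and>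
     (\<forall>r\<in>C 2. \<forall>m b. dt Y (theta2 Y r m b) = prod_of (xB Y) r (dt Y m) b) \<and>
     (\<forall>r\<in>C 2. \<forall>m n. theta1 Y r (dt Y m) n = prod_of (xA Y) r m n) \<and>
     (\<forall>r\<in>C 2. \<forall>m n. theta2 Y r m (dt Y n) = prod_of (xA Y) r m n) \<and>
     (\<forall>s\<in>C 3. \<forall>b m n.
        comp_2_2_2 (scale (xA Y)) (theta1 Y) (prod_of (xA Y)) s b m n =
        comp_2_2_1 (scale (xA Y)) (prod_of (xA Y)) (theta1 Y) s b m n) \<and>
     (\<forall>s\<in>C 3. \<forall>m n b.
        comp_2_2_1 (scale (xA Y)) (theta2 Y) (prod_of (xA Y)) s m n b =
        comp_2_2_2 (scale (xA Y)) (prod_of (xA Y)) (theta2 Y) s m n b)"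

text \<open>
  The correspondence keeps both vector spaces, the differential and all components of \<open>\<mu>\<^sub>2\<close>, and
  puts on \<open>A\<^sub>1\<close> the products \<open>\<mu>\<^sub>2([r]; d m, n)\<close>.
\<close>

definition crossed_module_of ::
  "('k::field_char_0, 'a1::ab_group_add, 'a0::ab_group_add) two_term \<Rightarrow> ('k, 'a1, 'a0) xmod" where
  "crossed_module_of X =
     \<lparr>xA = \<lparr>scale = scale1 X,
            dprec = (\<lambda>m n. mu01 X 1 (diff X m) n),
            dsucc = (\<lambda>m n. mu01 X 2 (diff X m) n)\<rparr>,
      xB = \<lparr>scale = scale0 X, dprec = mu00 X 1, dsucc = mu00 X 2\<rparr>,
      dt = diff X,
      theta1 = mu01 X,
      theta2 = mu10 X\<rparr>"

end

theory Submission
  imports Defs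
begin

text \<open>
  When \<open>\<mu>\<^sub>3 = 0\<close>, axiom (vii) is \<open>0 = 0\<close>, axiom (v) says that \<open>A\<^sub>0\<close> is a dendriform algebra, axioms
  (vi1)--(vi3) say that the mixed components of \<open>\<mu>\<^sub>2\<close> make \<open>A\<^sub>1\<close> a representation of it, and (ii), (iii)
  are the equivariance of \<open>d\<close>. This translation between labelled identities and (D1)--(D3) is
  \<open>comp_2_2_eq_iff\<close>. The product \<open>\<mu>\<^sub>2([r]; d m, n)\<close> on \<open>A\<^sub>1\<close>, which equals \<open>\<mu>\<^sub>2([r]; m, d n)\<close> by (iv),
  makes \<open>A\<^sub>1\<close> a dendriform algebra by (ii) and (vi1) evaluated at \<open>d m, d n, p\<close>, and the two
  compatibilities between this product and the actions are (ii) with (vi1) at \<open>b, d m, n\<close>, and (vi2)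
  at \<open>d m, n, b\<close>.

  Conversely a crossed module determines \<open>\<mu>\<^sub>2\<close>, by the product of \<open>B\<close> and the two actions. The product
  of \<open>A\<close> is recovered from \<open>\<theta>\<^sub>1([r]; dt m, n) = \<pi>\<^sub>A([r]; m, n)\<close>, so the two constructions are mutually
  inverse.
\<close>

section \<open>Labelled identities\<close>

lemma C_2: "C 2 = {1, 2}" and C_3: "C 3 = {1, 2, 3}"
  by (auto simp: C_def)

lemma comp_2_2_1_simps:
  assumes "vector_space s"
  shows "comp_2_2_1 s f g 1 a b c = f 1 (g 1 a b) c"
    and "comp_2_2_1 s f g 2 a b c = f 1 (g 2 a b) c"
    and "comp_2_2_1 s f g 3 a b c = f 2 (g 1 a b + g 2 a b) c"
proof -
  interpret vector_space s by fact
  show "comp_2_2_1 s f g 1 a b c = f 1 (g 1 a b) c"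
    and "comp_2_2_1 s f g 2 a b c = f 1 (g 2 a b) c"
    and "comp_2_2_1 s f g 3 a b c = f 2 (g 1 a b + g 2 a b) c"
    by (simp_all add: comp_2_2_1_def insert_op_def label_extend_def R0_def R_def C_2)
      (simp add: numeral_2_eq_2)
qed

lemma comp_2_2_2_simps:
  assumes "vector_space s"
  shows "comp_2_2_2 s f g 1 a b c = f 1 a (g 1 b c + g 2 b c)"
    and "comp_2_2_2 s f g 2 a b c = f 2 a (g 1 b c)"
    and "comp_2_2_2 s f g 3 a b c = f 2 a (g 2 b c)"
proof -
  interpret vector_space s by fact
  show "comp_2_2_2 s f g 1 a b c = f 1 a (g 1 b c + g 2 b c)"
    and "comp_2_2_2 s f g 2 a b c = f 2 a (g 1 b c)"
    and "comp_2_2_2 s f g 3 a b c = f 2 a (g 2 b c)"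
    by (simp_all add: comp_2_2_2_def insert_op_def label_extend_def R0_def R_def C_2)
qed

text \<open>
  The labels \<open>[1], [2], [3]\<close> of \<open>f \<circ>\<^sub>1 g = h \<circ>\<^sub>2 k\<close> are the three dendriform axioms, in order. The four
  operations are independent, so that the lemma also covers axioms with one input in a
  representation.
\<close>

lemma comp_2_2_eq_iff:
  assumes "vector_space s" "vector_space s'"
  shows "(\<forall>l\<in>C 3. comp_2_2_1 s f g l a b c = comp_2_2_2 s' h k l a b c) \<longleftrightarrow>
      f 1 (g 1 a b) c = h 1 a (k 1 b c + k 2 b c) \<and>
      f 1 (g 2 a b) c = h 2 a (k 1 b c) \<and>
      f 2 (g 1 a b + g 2 a b) c = h 2 a (k 2 b c)"
  by (simp add: C_3 comp_2_2_1_simps[OF assms(1)] comp_2_2_2_simps[OF assms(2)]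
      del: One_nat_def)

lemma linear_vector_spaces:
  assumes "Vector_Spaces.linear s t f"
  shows "vector_space s" "vector_space t"
  using assms unfolding Vector_Spaces.linear_def by blast+

lemma labelled_bilinear_zero:
  assumes "labelled_bilinear n sx sy sz f"
  shows "f r x 0 = 0" "f r 0 y = 0"
proof -
  consider "r \<in> C n" | "f r = (\<lambda>x y. 0)"
    using assms unfolding labelled_bilinear_def by blast
  then have "f r x 0 = 0 \<and> f r 0 y = 0"
  proof cases
    case 1
    then have "Vector_Spaces.linear sy sz (f r x)" "Vector_Spaces.linear sx sz (\<lambda>x. f r x y)"
      using assms unfolding labelled_bilinear_def bilinear_map_def by blast+
    then show ?thesis
      by (auto simp: linear_iff_module_hom dest: module_hom.zero)
  qed simp
  then show "f r x 0 = 0" "f r 0 y = 0" by auto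
qed

lemma bilinear_map_compose_left:
  assumes "bilinear_map sx sy sz f" "Vector_Spaces.linear sw sx g"
  shows "bilinear_map sw sy sz (\<lambda>w. f (g w))"
  using assms Vector_Spaces.linear_compose[of sw sx g sz] unfolding bilinear_map_def
  by (auto simp: o_def)

lemma prod_of_simps: "prod_of D 1 = dprec D" "prod_of D 2 = dsucc D"
  by (simp_all add: prod_of_def fun_eq_iff)

lemma labelled_bilinear_2_prod_of:
  "labelled_bilinear 2 s s s (prod_of D) \<longleftrightarrow>
     bilinear_map s s s (dprec D) \<and> bilinear_map s s s (dsucc D)"
  using prod_of_simps[of D] by (auto simp: labelled_bilinear_def C_2)
    (auto simp: prod_of_def fun_eq_iff)

lemma dendriform_algebra_iff:
  "dendriform_algebra D \<longleftrightarrow>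
     vector_space (scale D) \<and> labelled_bilinear 2 (scale D) (scale D) (scale D) (prod_of D) \<and>
     (\<forall>a b c. \<forall>l\<in>C 3. comp_2_2_1 (scale D) (prod_of D) (prod_of D) l a b c =
                      comp_2_2_2 (scale D) (prod_of D) (prod_of D) l a b c)"
proof (cases "vector_space (scale D)")
  case True
  then show ?thesis
    unfolding dendriform_algebra_def dendriform_axioms_def dendriform_axioms_axioms_def
      labelled_bilinear_2_prod_of comp_2_2_eq_iff[OF True True]
    by (auto simp: prod_of_def)
qed (simp add: dendriform_algebra_def dendriform_axioms_def)

text \<open>
  The three families are (D1)--(D3) with the element of the module in the third, the second and the
  first position; they are the shape of axioms (vi1)--(vi3) for \<open>\<mu>\<^sub>3 = 0\<close>.
\<close>

lemma dendriform_representation_iff: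
  assumes "dendriform_algebra B" "vector_space sM"
    and "labelled_bilinear 2 (scale B) sM sM \<theta>\<^sub>1" "labelled_bilinear 2 sM (scale B) sM \<theta>\<^sub>2"
  shows "dendriform_representation B sM (\<theta>\<^sub>1 1) (\<theta>\<^sub>1 2) (\<theta>\<^sub>2 1) (\<theta>\<^sub>2 2) \<longleftrightarrow>
     (\<forall>a b m. \<forall>l\<in>C 3. comp_2_2_1 (scale B) \<theta>\<^sub>1 (prod_of B) l a b m = comp_2_2_2 sM \<theta>\<^sub>1 \<theta>\<^sub>1 l a b m) \<and>
     (\<forall>a m c. \<forall>l\<in>C 3. comp_2_2_1 sM \<theta>\<^sub>2 \<theta>\<^sub>1 l a m c = comp_2_2_2 sM \<theta>\<^sub>1 \<theta>\<^sub>2 l a m c) \<and>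
     (\<forall>m b c. \<forall>l\<in>C 3. comp_2_2_1 sM \<theta>\<^sub>2 \<theta>\<^sub>2 l m b c = comp_2_2_2 (scale B) \<theta>\<^sub>2 (prod_of B) l m b c)"
proof -
  have B: "vector_space (scale B)" and dend: "dendriform_axioms (scale B) (dprec B) (dsucc B)"
    using assms(1) by (simp_all add: dendriform_algebra_iff dendriform_algebra_def[symmetric])
  have bil: "bilinear_map (scale B) sM sM (\<theta>\<^sub>1 1)" "bilinear_map (scale B) sM sM (\<theta>\<^sub>1 2)"
      "bilinear_map sM (scale B) sM (\<theta>\<^sub>2 1)" "bilinear_map sM (scale B) sM (\<theta>\<^sub>2 2)"
    using assms(3,4) unfolding labelled_bilinear_def C_2 by blast+
  show ?thesis
    unfolding dendriform_representation_def dendriform_rep_axioms_def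
      dendriform_rep_axioms_axioms_def comp_2_2_eq_iff[OF B assms(2)]
      comp_2_2_eq_iff[OF assms(2) assms(2)] comp_2_2_eq_iff[OF assms(2) B] prod_of_simps
    by (simp only: all_conj_distrib dend assms(2) bil simp_thms conj_ac)
qed


section \<open>Strict \<open>Dend\<^sub>\<infinity>\<close>-algebras\<close>

text \<open>
  The axioms of a strict algebra, with \<open>\<mu>\<^sub>3\<close> eliminated. The identities (v) and (vi1)--(vi3) then
  have the form used in \<open>dendriform_algebra_iff\<close> and \<open>dendriform_representation_iff\<close>.
\<close>

lemma strict_dend_infty_iff:
  "strict_dend_infty X \<longleftrightarrow>
     Vector_Spaces.linear (scale1 X) (scale0 X) (diff X) \<and>
     labelled_bilinear 2 (scale0 X) (scale0 X) (scale0 X) (mu00 X) \<and>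
     labelled_bilinear 2 (scale0 X) (scale1 X) (scale1 X) (mu01 X) \<and>
     labelled_bilinear 2 (scale1 X) (scale0 X) (scale1 X) (mu10 X) \<and>
     (\<forall>r\<in>C 2. \<forall>a m. diff X (mu01 X r a m) = mu00 X r a (diff X m)) \<and>
     (\<forall>r\<in>C 2. \<forall>m a. diff X (mu10 X r m a) = mu00 X r (diff X m) a) \<and>
     (\<forall>r\<in>C 2. \<forall>m n. mu01 X r (diff X m) n = mu10 X r m (diff X n)) \<and>
     (\<forall>a b c. \<forall>l\<in>C 3. comp_2_2_1 (scale0 X) (mu00 X) (mu00 X) l a b c =
                      comp_2_2_2 (scale0 X) (mu00 X) (mu00 X) l a b c) \<and>
     (\<forall>a b m. \<forall>l\<in>C 3. comp_2_2_1 (scale0 X) (mu01 X) (mu00 X) l a b m =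
                      comp_2_2_2 (scale1 X) (mu01 X) (mu01 X) l a b m) \<and>
     (\<forall>a m c. \<forall>l\<in>C 3. comp_2_2_1 (scale1 X) (mu10 X) (mu01 X) l a m c =
                      comp_2_2_2 (scale1 X) (mu01 X) (mu10 X) l a m c) \<and>
     (\<forall>m b c. \<forall>l\<in>C 3. comp_2_2_1 (scale1 X) (mu10 X) (mu10 X) l m b c =
                      comp_2_2_2 (scale0 X) (mu10 X) (mu00 X) l m b c) \<and>
     mu3 X = (\<lambda>s a b c. 0)"
  (is "_ \<longleftrightarrow> ?lin \<and> _ \<and> ?b01 \<and> ?b10 \<and> _ \<and> _ \<and> _ \<and> _ \<and> _ \<and> _ \<and> _ \<and> ?z")
proof (cases "?lin \<and> ?b01 \<and> ?b10 \<and> ?z")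
  case True
  then have lin: ?lin and b01: ?b01 and b10: ?b10 and z: ?z by blast+
  interpret A1: vector_space "scale1 X" using lin by (rule linear_vector_spaces)
  interpret A0: vector_space "scale0 X" using lin by (rule linear_vector_spaces)
  interpret d: Vector_Spaces.linear "scale1 X" "scale0 X" "diff X" by (fact lin)
  have tri: "labelled_trilinear 3 (scale0 X) (scale0 X) (scale0 X) (scale1 X) (\<lambda>s a b c. 0)"
    unfolding labelled_trilinear_def trilinear_map_def
    by (simp add: A0.vector_space_axioms A1.vector_space_axioms
        vector_space_pair.linear_zero vector_space_pair.intro)
  show ?thesis
    unfolding strict_dend_infty_def two_term_dend_infty_def two_term_axioms_def
      two_term_axioms_axioms_def z
    using lin tri A0.vector_space_axioms A1.vector_space_axioms
    by (auto simp: d.zero comp_3_2_1_def comp_3_2_2_def comp_3_2_3_def comp_2_3_1_def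
        comp_2_3_2_def insert_op_def label_extend_def labelled_bilinear_zero[OF b01]
        labelled_bilinear_zero[OF b10])
next
  case False
  then show ?thesis
    unfolding strict_dend_infty_def two_term_dend_infty_def two_term_axioms_def
      two_term_axioms_axioms_def by blast
qed


section \<open>The two constructions\<close>

text \<open>
  The inverse of \<open>crossed_module_of\<close>: the components of \<open>\<mu>\<^sub>2\<close> are the product of \<open>B\<close> and the two
  actions. The product of \<open>A\<close> is forgotten, being determined by \<open>dt\<close> and \<open>\<theta>\<^sub>1\<close>.
\<close>

definition two_term_of ::
  "('k::field_char_0, 'a1::ab_group_add, 'a0::ab_group_add) xmod \<Rightarrow> ('k, 'a1, 'a0) two_term" where
  "two_term_of Y =
     \<lparr>scale1 = scale (xA Y), scale0 = scale (xB Y), diff = dt Y, mu00 = prod_of (xB Y),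
      mu01 = theta1 Y, mu10 = theta2 Y, mu3 = (\<lambda>s a b c. 0)\<rparr>"

text \<open>
  These are equalities for all labels, because the axioms include the normalisation of \<open>\<mu>\<^sub>2\<close> to \<open>0\<close>
  outside \<open>C\<^sub>2\<close>. This normalisation is also what makes \<open>crossed_module_of\<close> injective.
\<close>

lemma prod_of_crossed_module_of:
  assumes "strict_dend_infty X"
  shows "prod_of (xB (crossed_module_of X)) = mu00 X"
    and "prod_of (xA (crossed_module_of X)) = (\<lambda>r m n. mu01 X r (diff X m) n)"
proof -
  have "mu00 X r = (\<lambda>a b. 0)" "mu01 X r = (\<lambda>a b. 0)" if "r \<noteq> 1" "r \<noteq> 2" for r
    using assms that by (auto simp: strict_dend_infty_iff labelled_bilinear_def C_2)
  then show "prod_of (xB (crossed_module_of X)) = mu00 X"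
    and "prod_of (xA (crossed_module_of X)) = (\<lambda>r m n. mu01 X r (diff X m) n)"
    by (auto simp: prod_of_def crossed_module_of_def fun_eq_iff)
qed

lemma crossed_module_crossed_module_of:
  assumes X: "strict_dend_infty X"
  shows "crossed_module (crossed_module_of X)"
proof -
  let ?Y = "crossed_module_of X"
  let ?d = "diff X"
  have sel: "scale (xA ?Y) = scale1 X" "scale (xB ?Y) = scale0 X" "dt ?Y = diff X"
      "theta1 ?Y = mu01 X" "theta2 ?Y = mu10 X"
    by (simp_all add: crossed_module_of_def)
  note prods = prod_of_crossed_module_of[OF X]
  note X' = X[unfolded strict_dend_infty_iff]
  have lin: "Vector_Spaces.linear (scale1 X) (scale0 X) ?d"
    and b01: "labelled_bilinear 2 (scale0 X) (scale1 X) (scale1 X) (mu01 X)"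
    and b10: "labelled_bilinear 2 (scale1 X) (scale0 X) (scale1 X) (mu10 X)"
    and d01: "\<And>r a m. r \<in> C 2 \<Longrightarrow> ?d (mu01 X r a m) = mu00 X r a (?d m)"
    and d10: "\<And>r a m. r \<in> C 2 \<Longrightarrow> ?d (mu10 X r m a) = mu00 X r (?d m) a"
    and iv: "\<And>r m n. r \<in> C 2 \<Longrightarrow> mu01 X r (?d m) n = mu10 X r m (?d n)"
    using X' by simp_all
  note vs = linear_vector_spaces[OF lin]
  interpret d: Vector_Spaces.linear "scale1 X" "scale0 X" ?d by (fact lin)
  have d12: "?d (mu01 X 1 a m) = mu00 X 1 a (?d m)" "?d (mu01 X 2 a m) = mu00 X 2 a (?d m)"
    for a m using d01 by (simp_all add: C_2)
  have vi1: "\<forall>l\<in>C 3. comp_2_2_1 (scale0 X) (mu01 X) (mu00 X) l a b m =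
                      comp_2_2_2 (scale1 X) (mu01 X) (mu01 X) l a b m"
    and vi2: "\<forall>l\<in>C 3. comp_2_2_1 (scale1 X) (mu10 X) (mu01 X) l a m b =
                      comp_2_2_2 (scale1 X) (mu01 X) (mu10 X) l a m b" for a b m
    using X' by blast+
  note vi1' = vi1[unfolded comp_2_2_eq_iff[OF vs(2,1)]]
  note vi2' = vi2[unfolded comp_2_2_eq_iff[OF vs(1,1)]]
  have B: "dendriform_algebra (xB ?Y)"
    unfolding dendriform_algebra_iff sel prods using X' vs by blast
  have A: "dendriform_algebra (xA ?Y)"
  proof -
    have "labelled_bilinear 2 (scale1 X) (scale1 X) (scale1 X) (\<lambda>r m n. mu01 X r (?d m) n)"
      using b01 unfolding labelled_bilinear_def
      by (auto intro: bilinear_map_compose_left[OF _ lin])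
    moreover have "\<forall>l\<in>C 3.
        comp_2_2_1 (scale1 X) (\<lambda>r m n. mu01 X r (?d m) n) (\<lambda>r m n. mu01 X r (?d m) n) l m n p =
        comp_2_2_2 (scale1 X) (\<lambda>r m n. mu01 X r (?d m) n) (\<lambda>r m n. mu01 X r (?d m) n) l m n p"
      for m n p
      unfolding comp_2_2_eq_iff[OF vs(1,1)] using vi1'[of "?d m" "?d n" p]
      by (simp add: d12 d.add del: One_nat_def)
    ultimately show ?thesis
      unfolding dendriform_algebra_iff sel prods using vs by blast
  qed
  have mor: "dendriform_morphism (xA ?Y) (xB ?Y) (dt ?Y)"
    unfolding dendriform_morphism_def sel using lin d12
    by (simp add: crossed_module_of_def)
  have rep: "dendriform_representation (xB ?Y) (scale1 X) (mu01 X 1) (mu01 X 2) (mu10 X 1) (mu10 X 2)"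
    using dendriform_representation_iff[OF B vs(1), of "mu01 X" "mu10 X"] X'
    unfolding sel prods by blast
  have c1: "\<forall>l\<in>C 3. comp_2_2_2 (scale1 X) (mu01 X) (\<lambda>r m n. mu01 X r (?d m) n) l b m n =
        comp_2_2_1 (scale1 X) (\<lambda>r m n. mu01 X r (?d m) n) (mu01 X) l b m n" for b m n
  proof -
    have "\<forall>l\<in>C 3. comp_2_2_1 (scale1 X) (\<lambda>r m n. mu01 X r (?d m) n) (mu01 X) l b m n =
        comp_2_2_2 (scale1 X) (mu01 X) (\<lambda>r m n. mu01 X r (?d m) n) l b m n"
      unfolding comp_2_2_eq_iff[OF vs(1,1)] using vi1'[of b "?d m" n]
      by (simp add: d12 d.add del: One_nat_def)
    then show ?thesis by simp
  qed
  have c2: "\<forall>l\<in>C 3. comp_2_2_1 (scale1 X) (mu10 X) (\<lambda>r m n. mu01 X r (?d m) n) l m n b =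
        comp_2_2_2 (scale1 X) (\<lambda>r m n. mu01 X r (?d m) n) (mu10 X) l m n b" for m n b
    unfolding comp_2_2_eq_iff[OF vs(1,1)] using vi2'[of "?d m" n b] by simp
  show ?thesis
    unfolding crossed_module_def
    using A B mor unfolding sel prods
    using b01 b10 rep d01 d10 iv c1 c2 by simp
qed

lemma strict_dend_infty_two_term_of:
  assumes Y: "crossed_module Y"
  shows "strict_dend_infty (two_term_of Y)"
proof -
  note Y' = Y[unfolded crossed_module_def]
  have B: "dendriform_algebra (xB Y)"
    and lin: "Vector_Spaces.linear (scale (xA Y)) (scale (xB Y)) (dt Y)"
    and b1: "labelled_bilinear 2 (scale (xB Y)) (scale (xA Y)) (scale (xA Y)) (theta1 Y)"
    and b2: "labelled_bilinear 2 (scale (xA Y)) (scale (xB Y)) (scale (xA Y)) (theta2 Y)"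
    and rep: "dendriform_representation (xB Y) (scale (xA Y))
       (theta1 Y 1) (theta1 Y 2) (theta2 Y 1) (theta2 Y 2)"
    using Y' unfolding dendriform_morphism_def by blast+
  show ?thesis
    unfolding strict_dend_infty_iff two_term_of_def two_term.simps
    using lin b1 b2 B[unfolded dendriform_algebra_iff] Y'
      rep[unfolded dendriform_representation_iff[OF B linear_vector_spaces(1)[OF lin] b1 b2]]
    by simp
qed

lemma two_term_of_crossed_module_of:
  assumes "strict_dend_infty X"
  shows "two_term_of (crossed_module_of X) = X"
  using prod_of_crossed_module_of(1)[OF assms] assms
  by (simp add: two_term_of_def strict_dend_infty_def) (simp add: crossed_module_of_def)

lemma crossed_module_of_two_term_of:
  assumes "crossed_module Y"
  shows "crossed_module_of (two_term_of Y) = Y"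
proof -
  have "theta1 Y 1 (dt Y m) n = dprec (xA Y) m n" "theta1 Y 2 (dt Y m) n = dsucc (xA Y) m n"
    for m n
    using assms unfolding crossed_module_def by (auto simp: C_2 prod_of_def)
  then show ?thesis
    by (simp add: prod_of_simps crossed_module_of_def two_term_of_def del: One_nat_def)
qed

theorem theorem6p7:
  "bij_betw crossed_module_of
     {X :: ('k::field_char_0, 'a1::ab_group_add, 'a0::ab_group_add) two_term. strict_dend_infty X}
     {Y :: ('k, 'a1, 'a0) xmod. crossed_module Y}"
  by (rule bij_betw_byWitness[where f' = two_term_of])
    (auto simp: two_term_of_crossed_module_of crossed_module_of_two_term_of
      crossed_module_crossed_module_of strict_dend_infty_two_term_of)

end
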